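(* For every integer $r\geq 0$, $$t(\underbrace{2,2,\ldots,2}_{r},3)=-4(r+1)\left(\sum_{n=0}^{\infty}\frac{\zeta(2n)}{(2n+2r+1)(2n+2r+2)\,2^{2n}}\right)t(\underbrace{2,2,\ldots,2}_{r+1}).$$
   Context: For positive integers $k_1,\ldots,k_m$ with $k_m>1$, the multiple $t$-value is $t(k_1,\ldots,k_m)=\sum_{1\leq n_1<n_2<\cdots<n_m}\frac{1}{(2n_1-1)^{k_1}(2n_2-1)^{k_2}\cdots(2n_m-1)^{k_m}}$. Thus $t(\underbrace{2,\ldots,2}_{r},3)=\sum_{1\le n_1<\cdots<n_{r+1}}\frac{1}{(2n_1-1)^2\cdots(2n_r-1)^2(2n_{r+1}-1)^3}$. In the series, $\zeta(2n)$ is the Riemann zeta value, with $\zeta(0)=-\tfrac12$ for the $n=0$ term. *)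

theory Defs
  imports "HOL-Analysis.Analysis"
begin

text \<open>Riemann zeta at even non-negative integers: zeta_even n = zeta(2n) for n >= 1
  (the series sum over k >= 1 of 1/k^(2n)), and zeta_even 0 = zeta(0) = -1/2.\<close>
definition zeta_even :: "nat \<Rightarrow> real" where
  "zeta_even n = (if n = 0 then - 1 / 2 else (\<Sum>k. 1 / (real (Suc k)) ^ (2 * n)))"

definition mtv :: "nat list \<Rightarrow> real" where
  "mtv ks = infsum (\<lambda>ns. \<Prod>i<length ks. 1 / (2 * real (ns ! i) - 1) ^ (ks ! i))
     {ns. length ns = length ks \<and> sorted_wrt (<) ns \<and> (\<forall>n\<in>set ns. 1 \<le> n)}"

end

theory Submission
  imports Defs
begin

text \<open>
  Let \<open>a\<^sub>r(n)\<close> be the elementary symmetric polynomial of degree \<open>r\<close> in \<open>1 / (2k + 1)\<^sup>2\<close>, \<open>k < n\<close>, and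
  let \<open>c\<^sub>n\<close> be the Taylor coefficients of \<open>arcsin\<close>. For \<open>0 \<le> x < \<pi>/2\<close>,
  \<open>x\<^sup>2\<^sup>r\<^sup>+\<^sup>1 / (2r + 1)! = \<Sum>\<^sub>n a\<^sub>r(n) c\<^sub>n (sin x)\<^sup>2\<^sup>n\<^sup>+\<^sup>1\<close>: the second derivative of the remainder of a
  partial sum is the remainder for \<open>r - 1\<close> plus a vanishing positive term, so all remainders are
  nonnegative and tend to 0. Integrating this expansion termwise over \<open>(0, \<pi>/2)\<close> by Wallis'
  integrals gives \<open>t(2,\<dots>,2) = (\<pi>/2)\<^sup>2\<^sup>r\<^sup>+\<^sup>2 / (2r + 2)!\<close>, with \<open>r + 1\<close> twos, and integrating it against
  the weight \<open>(\<pi>/2 - x) cot x\<close> gives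
  \<open>t(2,\<dots>,2,3) = \<integral> x\<^sup>2\<^sup>r\<^sup>+\<^sup>1 / (2r + 1)! (\<pi>/2 - x) cot x dx\<close>. Expanding
  \<open>x cot x = -2 \<Sum>\<^sub>n \<zeta>(2n) (x/\<pi>)\<^sup>2\<^sup>n\<close>, the logarithmic derivative of the sine product, turns the
  latter integral into the zeta series.
\<close>

section \<open>Elementary symmetric sums of odd reciprocal squares\<close>

text \<open>The \<open>r\<close>-th elementary symmetric polynomial in \<open>1 / (2 k + 1)\<^sup>2\<close> for \<open>k < n\<close>.\<close>
primrec odd_esym :: "nat \<Rightarrow> nat \<Rightarrow> real" where
  "odd_esym 0 n = 1"
| "odd_esym (Suc r) n = (\<Sum>m<n. odd_esym r m / (2 * real m + 1) ^ 2)"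

lemma odd_esym_nonneg: "odd_esym r n \<ge> 0"
  by (induction r arbitrary: n) (auto intro!: sum_nonneg)

section \<open>Index lists of multiple t-values, split at the largest entry\<close>

definition incr_lists :: "nat \<Rightarrow> nat set \<Rightarrow> nat list set" where
  "incr_lists r A = {ns. length ns = r \<and> sorted_wrt (<) ns \<and> set ns \<subseteq> A}"

text \<open>Splits off the last entry, which is the largest. \<open>A\<close> is closed downwards in
  the positive integers, so the other entries need only lie below it. Writing the last entry as
  \<open>Suc m\<close> passes from the 1-based indices of \<open>mtv\<close> to the 0-based ones of
  \<open>odd_esym\<close>, since \<open>2 * (m + 1) - 1 = 2 * m + 1\<close>. It is used with
  \<open>A = {1..n}\<close> and \<open>A = {1..}\<close>.\<close>

lemma incr_lists_Suc:
  assumes "\<And>m. m \<in> A \<Longrightarrow> {1..<m} \<subseteq> A" "0 \<notin> A"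
  shows "bij_betw (\<lambda>(m, ns). ns @ [Suc m]) (Sigma {m. Suc m \<in> A} (\<lambda>m. incr_lists r {1..m}))
           (incr_lists (Suc r) A)"
proof (rule bij_betw_imageI)
  show "inj_on (\<lambda>(m, ns). ns @ [Suc m]) (Sigma {m. Suc m \<in> A} (\<lambda>m. incr_lists r {1..m}))"
    by (auto simp: inj_on_def)
  show "(\<lambda>(m, ns). ns @ [Suc m]) ` (Sigma {m. Suc m \<in> A} (\<lambda>m. incr_lists r {1..m}))
      = incr_lists (Suc r) A"
  proof (intro equalityI subsetI)
    fix xs assume "xs \<in> (\<lambda>(m, ns). ns @ [Suc m]) ` (Sigma {m. Suc m \<in> A} (\<lambda>m. incr_lists r {1..m}))"
    then obtain m ns where "xs = ns @ [Suc m]" "Suc m \<in> A" "ns \<in> incr_lists r {1..m}" by auto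
    moreover have "set ns \<subseteq> A"
    proof -
      have "set ns \<subseteq> {1..<Suc m}" using calculation(3) by (auto simp: incr_lists_def)
      thus ?thesis using assms(1)[OF calculation(2)] by blast
    qed
    ultimately show "xs \<in> incr_lists (Suc r) A"
      by (auto simp: incr_lists_def sorted_wrt_append less_Suc_eq_le subset_iff)
  next
    fix xs assume xs: "xs \<in> incr_lists (Suc r) A"
    then obtain ns k where [simp]: "xs = ns @ [k]"
      by (cases xs rule: rev_cases) (auto simp: incr_lists_def)
    have k: "k \<in> A" "k > 0" using xs assms(2) by (auto simp: incr_lists_def intro: ccontr)
    have "x \<noteq> 0" if "x \<in> set ns" for x
      using that assms(2) xs by (auto simp: incr_lists_def subset_iff intro: ccontr)
    then have "ns \<in> incr_lists r {1..k - 1}"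
      using xs by (fastforce simp: incr_lists_def sorted_wrt_append Suc_le_eq)
    with k show "xs \<in> (\<lambda>(m, ns). ns @ [Suc m]) ` (Sigma {m. Suc m \<in> A} (\<lambda>m. incr_lists r {1..m}))"
      by (intro image_eqI[of _ _ "(k - 1, ns)"]) auto
  qed
qed

lemma finite_incr_lists: "finite A \<Longrightarrow> finite (incr_lists r A)"
  by (rule finite_subset[OF _ finite_lists_length_eq[of A r]]) (auto simp: incr_lists_def)

text \<open>Induction on \<open>r\<close>: fixing the largest index turns the sum over lists into
  the recursion of \<open>odd_esym\<close>.\<close>

lemma odd_esym_eq_sum:
  "(\<Sum>ns\<in>incr_lists r {1..n}. \<Prod>i<r. 1 / (2 * real (ns ! i) - 1) ^ 2) = odd_esym r n"
proof (induction r arbitrary: n)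
  case 0
  have "incr_lists 0 {1..n} = {[]}" by (auto simp: incr_lists_def)
  then show ?case by simp
next
  case (Suc r)
  have *: "{m. Suc m \<in> {1..n}} = {..<n}" by auto
  have bij: "bij_betw (\<lambda>(m, ns). ns @ [Suc m]) (Sigma {..<n} (\<lambda>m. incr_lists r {1..m}))
           (incr_lists (Suc r) {1..n})"
    by (rule incr_lists_Suc[of "{1..n}" r, unfolded *]) auto
  have "(\<Sum>ns\<in>incr_lists (Suc r) {1..n}. \<Prod>i<Suc r. 1 / (2 * real (ns ! i) - 1) ^ 2)
      = (\<Sum>(m, ns)\<in>Sigma {..<n} (\<lambda>m. incr_lists r {1..m}).
          \<Prod>i<Suc r. 1 / (2 * real ((ns @ [Suc m]) ! i) - 1) ^ 2)"
    by (subst sum.reindex_bij_betw[OF bij, symmetric]) (simp add: case_prod_unfold)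
  also have "\<dots> = (\<Sum>m<n. \<Sum>ns\<in>incr_lists r {1..m}.
          \<Prod>i<Suc r. 1 / (2 * real ((ns @ [Suc m]) ! i) - 1) ^ 2)"
    by (subst sum.Sigma) (auto simp: finite_incr_lists)
  also have "\<dots> = (\<Sum>m<n. \<Sum>ns\<in>incr_lists r {1..m}.
          (\<Prod>i<r. 1 / (2 * real (ns ! i) - 1) ^ 2) * (1 / (2 * real m + 1) ^ 2))"
    by (intro sum.cong refl) (auto simp: incr_lists_def nth_append intro!: prod.cong)
  finally show ?case by (simp only: Suc.IH flip: sum_distrib_right) simp
qed

text \<open>Groups the multiple sum by its largest index \<open>Suc m\<close>. The remaining indices
  range over a finite set and contribute \<open>odd_esym r m\<close>. All terms are nonnegative, so
  convergence of the outer series gives the unconditional summability behind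
  \<open>infsum\<close>.\<close>

lemma mtv_eqI:
  assumes "(\<lambda>n. odd_esym r n / (2 * real n + 1) ^ k) sums S"
  shows "mtv (replicate r 2 @ [k]) = S"
proof -
  define F where "F = (\<lambda>ns::nat list. \<Prod>i<Suc r. 1 / (2 * real (ns ! i) - 1) ^ ((replicate r 2 @ [k]) ! i))"
  have F: "F (ns @ [Suc m]) = (\<Prod>i<r. 1 / (2 * real (ns ! i) - 1) ^ 2) * (1 / (2 * real m + 1) ^ k)"
    if "ns \<in> incr_lists r {1..m}" for m ns
  proof -
    have len: "length ns = r" using that by (simp add: incr_lists_def)
    have "2 * real (Suc m) - 1 = 2 * real m + 1" by simp
    moreover have "(\<Prod>i<r. 1 / (2 * real ((ns @ [Suc m]) ! i) - 1) ^ ((replicate r 2 @ [k]) ! i)) =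
        (\<Prod>i<r. 1 / (2 * real (ns ! i) - 1) ^ 2)"
      by (intro prod.cong refl) (simp add: nth_append len)
    ultimately show ?thesis
      unfolding F_def prod.lessThan_Suc by (simp only: nth_append_length len[symmetric] length_replicate)
        (simp add: nth_append len)
  qed
  have "((\<lambda>(m, ns). F (ns @ [Suc m])) has_sum S) (Sigma UNIV (\<lambda>m. incr_lists r {1..m}))"
  proof (rule has_sum_SigmaI)
    show g: "((\<lambda>n. odd_esym r n / (2 * real n + 1) ^ k) has_sum S) UNIV"
      by (rule sums_nonneg_imp_has_sum[OF assms]) (simp add: odd_esym_nonneg)
    show f: "((\<lambda>ns. case (m, ns) of (m, ns) \<Rightarrow> F (ns @ [Suc m])) has_sum
            odd_esym r m / (2 * real m + 1) ^ k) (incr_lists r {1..m})" for m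
    proof (rule has_sum_finiteI)
      have "(\<Sum>ns\<in>incr_lists r {1..m}. F (ns @ [Suc m])) =
          (\<Sum>ns\<in>incr_lists r {1..m}. (\<Prod>i<r. 1 / (2 * real (ns ! i) - 1) ^ 2) * (1 / (2 * real m + 1) ^ k))"
        by (intro sum.cong refl F)
      then show "odd_esym r m / (2 * real m + 1) ^ k =
          (\<Sum>ns\<in>incr_lists r {1..m}. case (m, ns) of (m, ns) \<Rightarrow> F (ns @ [Suc m]))"
        by (simp only: odd_esym_eq_sum flip: sum_distrib_right) simp
    qed (simp add: finite_incr_lists)
    show "(\<lambda>(m, ns). F (ns @ [Suc m])) summable_on (Sigma UNIV (\<lambda>m. incr_lists r {1..m}))"
    proof (rule summable_on_SigmaI[OF f])
      show "(case (m, ns) of (m, ns) \<Rightarrow> F (ns @ [Suc m])) \<ge> 0" if "ns \<in> incr_lists r {1..m}" for m ns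
        using that by (auto simp: F intro!: divide_nonneg_nonneg prod_nonneg)
    qed (use g in \<open>auto simp: summable_on_def\<close>)
  qed
  moreover have "bij_betw (\<lambda>(m, ns). ns @ [Suc m]) (Sigma UNIV (\<lambda>m. incr_lists r {1..m}))
           (incr_lists (Suc r) {1..})"
  proof -
    have *: "{m. Suc m \<in> {1..}} = UNIV" by auto
    show ?thesis by (rule incr_lists_Suc[of "{1..}" r, unfolded *]) auto
  qed
  ultimately have "(F has_sum S) (incr_lists (Suc r) {1..})"
    by (subst has_sum_reindex_bij_betw[symmetric]) (auto simp: case_prod_unfold)
  moreover have "incr_lists (Suc r) {1..} =
      {ns. length ns = Suc r \<and> sorted_wrt (<) ns \<and> (\<forall>n\<in>set ns. 1 \<le> n)}"
    by (auto simp: incr_lists_def)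
  ultimately have "infsum F {ns. length ns = Suc r \<and> sorted_wrt (<) ns \<and> (\<forall>n\<in>set ns. 1 \<le> n)} = S"
    by (simp only: infsumI)
  moreover have "length (replicate r 2 @ [k]) = Suc r" by simp
  ultimately show ?thesis unfolding mtv_def F_def by (simp only:)
qed

section \<open>Expansion of odd powers of the angle in powers of the sine\<close>

text \<open>In closed form this is \<open>binomial(2n, n) / (4^n * (2n + 1))\<close>. The ratio of
  successive coefficients is the form used later, both for second derivatives and for Wallis'
  integrals.\<close>

primrec arcsin_coeff :: "nat \<Rightarrow> real" where
  "arcsin_coeff 0 = 1"
| "arcsin_coeff (Suc n) =
     arcsin_coeff n * (2 * real n + 1) ^ 2 / ((2 * real n + 2) * (2 * real n + 3))"

lemma arcsin_coeff_pos: "arcsin_coeff n > 0"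
  by (induction n) auto

lemma arcsin_coeff_Suc_mult:
  "arcsin_coeff (Suc n) * ((2 * real n + 2) * (2 * real n + 3)) = arcsin_coeff n * (2 * real n + 1) ^ 2"
  by simp

lemma arcsin_coeff_le_1: "arcsin_coeff n \<le> 1"
proof (induction n)
  case (Suc n)
  have "(2 * real n + 1) ^ 2 / ((2 * real n + 2) * (2 * real n + 3)) \<le> 1"
  proof (subst divide_le_eq_1_pos)
    show "0 < (2 * real n + 2) * (2 * real n + 3)" by (intro mult_pos_pos) auto
  qed (simp add: algebra_simps power2_eq_square)
  from mult_mono[OF Suc.IH this] show ?case by (simp add: arcsin_coeff_pos)
qed simp

text \<open>Each summation in the recursion costs at most a factor zeta(2), as
  \<open>2 * m + 1 \<ge> m + 1\<close>. Uniformity in \<open>n\<close> is the point: powers of the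
  sine supply the decay.\<close>

lemma odd_esym_le: "odd_esym r n \<le> (pi ^ 2 / 6) ^ r"
proof (induction r arbitrary: n)
  case (Suc r)
  have "odd_esym (Suc r) n \<le> (\<Sum>m<n. (pi ^ 2 / 6) ^ r * (1 / real ((m + 1) ^ 2)))"
    unfolding odd_esym.simps
  proof (rule sum_mono)
    fix m
    have "odd_esym r m * (1 / (2 * real m + 1) ^ 2) \<le> (pi ^ 2 / 6) ^ r * (1 / real ((m + 1) ^ 2))"
      by (intro mult_mono Suc.IH divide_left_mono) (auto simp: power_mono)
    then show "odd_esym r m / (2 * real m + 1) ^ 2 \<le> (pi ^ 2 / 6) ^ r * (1 / real ((m + 1) ^ 2))"
      by simp
  qed
  also have "\<dots> = (pi ^ 2 / 6) ^ r * (\<Sum>m<n. 1 / real ((m + 1) ^ 2))"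
    by (simp add: sum_distrib_left)
  also have "\<dots> \<le> (pi ^ 2 / 6) ^ r * (pi ^ 2 / 6)"
  proof (rule mult_left_mono)
    show "(\<Sum>m<n. 1 / real ((m + 1) ^ 2)) \<le> pi ^ 2 / 6"
      using sum_le_suminf[OF sums_summable[OF inverse_squares_sums], of "{..<n}"]
        sums_unique[OF inverse_squares_sums] by simp
  qed simp
  finally show ?case by (simp only: power_Suc2)
qed simp

text \<open>Partial sums of the series for
  \<open>x ^ (2 * r + 1) / fact (2 * r + 1)\<close>.\<close>

definition sin_expansion :: "nat \<Rightarrow> nat \<Rightarrow> real \<Rightarrow> real" where
  "sin_expansion r N x = (\<Sum>n<N. odd_esym r n * arcsin_coeff n * sin x ^ (2 * n + 1))"

text \<open>The boundary term left over by two differentiations of a partial sum. At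
  \<open>N = 0\<close> the exponent is truncated to 0, but the factor \<open>2 * real N\<close>
  makes the term vanish.\<close>

definition sin_expansion_defect :: "nat \<Rightarrow> nat \<Rightarrow> real \<Rightarrow> real" where
  "sin_expansion_defect r N x =
     odd_esym r N * arcsin_coeff N * (2 * real N * (2 * real N + 1)) * sin x ^ (2 * N - 1)"

text \<open>Shifting the index in \<open>(sin\<^sup>m)'' = m (m - 1) sin\<^sup>m\<^sup>-\<^sup>2 - m\<^sup>2 sin\<^sup>m\<close>, the recursion of the
  coefficients cancels the \<open>arcsin\<close> factors and that of \<open>odd_esym\<close> lowers \<open>r\<close>; only the last
  term is left over.\<close>
lemma sin_expansion_deriv2_eq:
  "(\<Sum>n<N. odd_esym r n * arcsin_coeff n * (2 * real n + 1) *
       (2 * real n * sin x ^ (2 * n - 1) - (2 * real n + 1) * sin x ^ (2 * n + 1)))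
   = (case r of 0 \<Rightarrow> 0 | Suc r' \<Rightarrow> sin_expansion r' N x) - sin_expansion_defect r N x"
proof (induction N)
  case 0
  then show ?case by (simp add: sin_expansion_def sin_expansion_defect_def split: nat.splits)
next
  case (Suc N)
  have defect_Suc: "sin_expansion_defect r (Suc N) x =
      odd_esym r (Suc N) * arcsin_coeff N * (2 * real N + 1) ^ 2 * sin x ^ (2 * N + 1)"
  proof -
    have "2 * real (Suc N) * (2 * real (Suc N) + 1) = (2 * real N + 2) * (2 * real N + 3)"
      by (simp add: algebra_simps)
    moreover have "2 * Suc N - 1 = 2 * N + 1" by simp
    ultimately show ?thesis
      unfolding sin_expansion_defect_def by (simp only: mult.assoc arcsin_coeff_Suc_mult[unfolded mult.assoc])
  qed
  have esym_Suc: "odd_esym r (Suc N) * (2 * real N + 1) ^ 2 =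
      odd_esym r N * (2 * real N + 1) ^ 2 + (case r of 0 \<Rightarrow> 0 | Suc r' \<Rightarrow> odd_esym r' N)"
  proof (cases r)
    case (Suc r')
    have "(2 * real N + 1) ^ 2 \<noteq> 0" by (simp add: add_nonneg_eq_0_iff)
    then show ?thesis by (simp add: Suc distrib_right)
  qed simp
  have "sin_expansion_defect r (Suc N) x =
      odd_esym r N * arcsin_coeff N * (2 * real N + 1) ^ 2 * sin x ^ (2 * N + 1)
      + (case r of 0 \<Rightarrow> 0 | Suc r' \<Rightarrow> odd_esym r' N * arcsin_coeff N * sin x ^ (2 * N + 1))"
  proof -
    have "sin_expansion_defect r (Suc N) x =
      (odd_esym r (Suc N) * (2 * real N + 1) ^ 2) * (arcsin_coeff N * sin x ^ (2 * N + 1))"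
      by (simp only: defect_Suc mult_ac)
    then show ?thesis
      by (simp only: esym_Suc distrib_right) (simp add: mult_ac split: nat.splits)
  qed
  moreover have "(case r of 0 \<Rightarrow> 0 | Suc r' \<Rightarrow> sin_expansion r' (Suc N) x) =
      (case r of 0 \<Rightarrow> 0 | Suc r' \<Rightarrow> sin_expansion r' N x) +
      (case r of 0 \<Rightarrow> 0 | Suc r' \<Rightarrow> odd_esym r' N * arcsin_coeff N * sin x ^ (2 * N + 1))"
    by (simp add: sin_expansion_def split: nat.splits)
  moreover have "e * (2 * real N + 1) * (2 * real N * u - (2 * real N + 1) * v) =
      e * (2 * real N * (2 * real N + 1)) * u - e * (2 * real N + 1) ^ 2 * v" for e u v :: real
    by (simp add: algebra_simps power2_eq_square)
  \<comment> \<open>Here \<open>a\<close> and \<open>b + c\<close> are the defects at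
    \<open>N\<close> and \<open>Suc N\<close>, and \<open>c\<close> is the term that the expansion
    for \<open>r - 1\<close> gains, or 0 if \<open>r = 0\<close>.\<close>
  moreover have "l - a + (a - b) = l + c - (b + c)" for a b c l :: real
    by simp
  ultimately show ?case
    by (simp only: sum.lessThan_Suc Suc.IH sin_expansion_defect_def[of r N x])
qed

text \<open>Two applications of the mean value theorem give \<open>g t = g'' y * z * t\<close> with
  \<open>0 < y < z < t\<close>.\<close>

lemma second_order_bounds:
  fixes g g' g'' :: "real \<Rightarrow> real"
  assumes "\<And>x. (g has_real_derivative g' x) (at x)" "\<And>x. (g' has_real_derivative g'' x) (at x)"
    and "g 0 = 0" "g' 0 = 0" "t \<ge> 0"
    and "\<And>x. 0 \<le> x \<Longrightarrow> x \<le> t \<Longrightarrow> 0 \<le> g'' x \<and> g'' x \<le> M"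
  shows "0 \<le> g t" "g t \<le> M * t ^ 2"
proof -
  have "0 \<le> g t \<and> g t \<le> M * t ^ 2"
  proof (cases "t = 0")
    case False
    with assms(5) have "t > 0" by simp
    then obtain z where z: "0 < z" "z < t" "g t - g 0 = (t - 0) * g' z"
      using MVT2[of 0 t g g'] assms(1) by blast
    obtain y where y: "0 < y" "y < z" "g' z - g' 0 = (z - 0) * g'' y"
      using MVT2[of 0 z g' g''] assms(2) z(1) by blast
    have gy: "0 \<le> g'' y" "g'' y \<le> M" using assms(6)[of y] y z by auto
    have "g t = g'' y * (z * t)" using y z assms(3,4) by simp
    moreover have "g'' y * (z * t) \<le> M * (t * t)"
      using gy z by (intro mult_mono) auto
    ultimately show ?thesis using gy z by (simp add: power2_eq_square)
  qed (use assms in auto)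
  then show "0 \<le> g t" "g t \<le> M * t ^ 2" by auto
qed

section \<open>Remainders of the sine expansion and their decay\<close>

definition sin_expansion_rem :: "nat \<Rightarrow> nat \<Rightarrow> real \<Rightarrow> real" where
  "sin_expansion_rem r N x = x ^ (2 * r + 1) / fact (2 * r + 1) - sin_expansion r N x"

definition sin_expansion_rem_deriv :: "nat \<Rightarrow> nat \<Rightarrow> real \<Rightarrow> real" where
  "sin_expansion_rem_deriv r N x = x ^ (2 * r) / fact (2 * r) -
     (\<Sum>n<N. odd_esym r n * arcsin_coeff n * (2 * real n + 1) * sin x ^ (2 * n) * cos x)"

lemma DERIV_sin_power:
  "((\<lambda>x. sin x ^ (k + 1)) has_real_derivative (real k + 1) * (sin x ^ k * cos x)) (at x)"
  using DERIV_power[OF DERIV_sin, of "k + 1" x] by (simp add: mult_ac add_ac)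

lemma DERIV_sin_expansion_rem:
  "(sin_expansion_rem r N has_real_derivative sin_expansion_rem_deriv r N x) (at x)"
proof -
  have "((\<lambda>x. x ^ (2 * r + 1) / fact (2 * r + 1)) has_real_derivative
      (1 + 2 * real r) * x ^ (2 * r) / fact (2 * r + 1)) (at x)"
    using DERIV_cdivide[OF DERIV_pow[of "2 * r + 1" x], of "fact (2 * r + 1)"]
    by (simp del: fact_Suc)
  also have "(1 + 2 * real r) * x ^ (2 * r) / fact (2 * r + 1) = x ^ (2 * r) / fact (2 * r)"
  proof -
    have "1 + 2 * real r \<noteq> 0" by linarith
    moreover have "fact (2 * r + 1) = (1 + 2 * real r) * fact (2 * r)" by simp
    ultimately show ?thesis by (simp del: fact_Suc)
  qed
  finally have 1: "((\<lambda>x. x ^ (2 * r + 1) / fact (2 * r + 1)) has_real_derivative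
      x ^ (2 * r) / fact (2 * r)) (at x)" .
  have "((\<lambda>x. \<Sum>n<N. odd_esym r n * arcsin_coeff n * sin x ^ (2 * n + 1)) has_real_derivative
      (\<Sum>n<N. odd_esym r n * arcsin_coeff n * ((2 * real n + 1) * (sin x ^ (2 * n) * cos x)))) (at x)"
    by (intro DERIV_sum DERIV_cmult)
      (use DERIV_sin_power[of "2 * _"] in simp)
  from DERIV_diff[OF 1 this] show ?thesis
    by (simp only: sin_expansion_rem_def[abs_def] sin_expansion_rem_deriv_def sin_expansion_def mult.assoc)
qed

text \<open>Two derivatives lower \<open>r\<close> by one both in the power of \<open>x\<close> and
  in the partial sum, so the remainder reproduces itself up to the defect. For \<open>r = 0\<close>
  the power is \<open>x\<close> itself, whose second derivative is 0.\<close>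

lemma DERIV_sin_expansion_rem_deriv:
  "(sin_expansion_rem_deriv r N has_real_derivative
     (case r of 0 \<Rightarrow> 0 | Suc r' \<Rightarrow> sin_expansion_rem r' N x) + sin_expansion_defect r N x) (at x)"
proof -
  have "((\<lambda>x. x ^ (2 * r) / fact (2 * r)) has_real_derivative
      2 * real r * x ^ (2 * r - 1) / fact (2 * r)) (at x)"
    by (auto intro!: derivative_eq_intros)
  also have "2 * real r * x ^ (2 * r - 1) / fact (2 * r) =
      (case r of 0 \<Rightarrow> 0 | Suc r' \<Rightarrow> x ^ (2 * r' + 1) / fact (2 * r' + 1))"
    by (auto simp: divide_simps split: nat.splits)
  finally have 1: "((\<lambda>x. x ^ (2 * r) / fact (2 * r)) has_real_derivative
      (case r of 0 \<Rightarrow> 0 | Suc r' \<Rightarrow> x ^ (2 * r' + 1) / fact (2 * r' + 1))) (at x)" .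
  have 2: "((\<lambda>x. sin x ^ (2 * n) * cos x) has_real_derivative
      (2 * real n * sin x ^ (2 * n - 1) - (2 * real n + 1) * sin x ^ (2 * n + 1))) (at x)" for n
  proof -
    have "((\<lambda>x. sin x ^ (2 * n) * cos x) has_real_derivative
      (2 * real n * sin x ^ (2 * n - 1) * cos x ^ 2 - sin x ^ (2 * n + 1))) (at x)"
      by (auto intro!: derivative_eq_intros simp: power2_eq_square)
    also have "2 * real n * sin x ^ (2 * n - 1) * cos x ^ 2 - sin x ^ (2 * n + 1) =
        2 * real n * sin x ^ (2 * n - 1) - (2 * real n + 1) * sin x ^ (2 * n + 1)"
    \<comment> \<open>The exponent \<open>2 * n - 1\<close> is truncated at \<open>n = 0\<close>,
      where the factor \<open>2 * real n\<close> removes that power; for \<open>n > 0\<close> the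
      identity follows from \<open>cos^2 = 1 - sin^2\<close>.\<close>
    proof (cases n)
      case (Suc m)
      then have "sin x ^ (2 * n + 1) = sin x ^ (2 * n - 1) * sin x ^ 2"
        by (simp flip: power_add)
      then show ?thesis by (simp add: cos_squared_eq algebra_simps)
    qed simp
    finally show ?thesis .
  qed
  have "((\<lambda>x. \<Sum>n<N. odd_esym r n * arcsin_coeff n * (2 * real n + 1) * (sin x ^ (2 * n) * cos x))
      has_real_derivative (\<Sum>n<N. odd_esym r n * arcsin_coeff n * (2 * real n + 1) *
       (2 * real n * sin x ^ (2 * n - 1) - (2 * real n + 1) * sin x ^ (2 * n + 1)))) (at x)"
    by (intro DERIV_sum DERIV_cmult 2)
  from DERIV_diff[OF 1 this[unfolded sin_expansion_deriv2_eq]]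
  have "(sin_expansion_rem_deriv r N has_real_derivative
      (case r of 0 \<Rightarrow> 0 | Suc r' \<Rightarrow> x ^ (2 * r' + 1) / fact (2 * r' + 1)) -
      ((case r of 0 \<Rightarrow> 0 | Suc r' \<Rightarrow> sin_expansion r' N x) - sin_expansion_defect r N x)) (at x)"
    by (simp only: sin_expansion_rem_deriv_def[abs_def] mult.assoc)
  then show ?thesis by (cases r) (simp_all add: sin_expansion_rem_def diff_diff_eq2 diff_add_eq)
qed

text \<open>The sine increases on \<open>[0, pi/2]\<close>, so its value at \<open>t\<close> bounds
  the defect uniformly on \<open>[0, t]\<close>.\<close>

lemma sin_expansion_defect_bounds:
  assumes "0 \<le> x" "x \<le> t" "t \<le> pi / 2"
  shows "0 \<le> sin_expansion_defect r N x"
    "sin_expansion_defect r N x \<le> (pi ^ 2 / 6) ^ r * (2 * real N * (2 * real N + 1)) * sin t ^ (2 * N - 1)"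
proof -
  have s: "0 \<le> sin x" "sin x \<le> sin t"
    using assms by (auto intro!: sin_ge_zero sin_monotone_2pi_le)
  show "0 \<le> sin_expansion_defect r N x"
    unfolding sin_expansion_defect_def using s
    by (intro mult_nonneg_nonneg) (auto simp: odd_esym_nonneg arcsin_coeff_pos less_imp_le)
  have "odd_esym r N * arcsin_coeff N \<le> (pi ^ 2 / 6) ^ r * 1"
    by (intro mult_mono odd_esym_le arcsin_coeff_le_1)
      (auto simp: arcsin_coeff_pos less_imp_le)
  then show "sin_expansion_defect r N x
      \<le> (pi ^ 2 / 6) ^ r * (2 * real N * (2 * real N + 1)) * sin t ^ (2 * N - 1)"
    unfolding sin_expansion_defect_def using s
    by (intro mult_mono power_mono) auto
qed

lemma sin_expansion_defect_bound_tendsto_0: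
  assumes "0 \<le> s" "s < 1"
  shows "(\<lambda>N. C * (2 * real N * (2 * real N + 1)) * s ^ (2 * N - 1)) \<longlonglongrightarrow> (0::real)"
proof (rule LIMSEQ_imp_Suc)
  have *: "(\<lambda>n. s ^ n) \<longlonglongrightarrow> 0" "(\<lambda>n. real n * s ^ n) \<longlonglongrightarrow> 0"
    using assms powser_times_n_limit_0[of s] by (auto intro: LIMSEQ_power_zero)
  \<comment> \<open>With \<open>N = n + 1\<close> the exponent is \<open>2 * n + 1\<close>, free of
    truncation, and \<open>(2n + 2)(2n + 3) = 4n^2 + 10n + 6\<close>; hence the bound is a quadratic
    form in the null sequences \<open>n * s ^ n\<close> and \<open>s ^ n\<close>.\<close>
  have "(\<lambda>n. C * s * (4 * (real n * s ^ n) ^ 2 + 10 * (real n * s ^ n) * s ^ n + 6 * (s ^ n) ^ 2))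
      \<longlonglongrightarrow> C * s * (4 * 0 ^ 2 + 10 * 0 * 0 + 6 * 0 ^ 2)"
    by (intro tendsto_intros *)
  moreover have eq: "C * (2 * real (Suc n) * (2 * real (Suc n) + 1)) * s ^ (2 * Suc n - 1) =
      C * s * (4 * (real n * s ^ n) ^ 2 + 10 * (real n * s ^ n) * s ^ n + 6 * (s ^ n) ^ 2)" for n
  proof -
    have "s ^ (2 * Suc n - 1) = s * (s ^ n * s ^ n)"
      by (simp add: mult_2 flip: power_add)
    then show ?thesis by (simp only:) (simp add: algebra_simps power2_eq_square)
  qed
  ultimately show "(\<lambda>n. C * (2 * real (Suc n) * (2 * real (Suc n) + 1)) * s ^ (2 * Suc n - 1)) \<longlonglongrightarrow> 0"
    by (simp only: eq) simp
qed

text \<open>Induction on \<open>r\<close>: the bound for \<open>r - 1\<close> and the defect bound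
  control the second derivative, and integrating twice from 0 controls the remainder. Since the
  whole interval enters, the bound \<open>M N\<close> has to be uniform on \<open>[0, t]\<close>; it
  tends to 0 because \<open>sin t < 1\<close>.\<close>

lemma sin_expansion_rem_bounds:
  assumes "0 \<le> t" "t < pi / 2"
  shows "\<exists>M. M \<longlonglongrightarrow> 0 \<and>
    (\<forall>N x. N > 0 \<longrightarrow> 0 \<le> x \<longrightarrow> x \<le> t \<longrightarrow> 0 \<le> sin_expansion_rem r N x \<and> sin_expansion_rem r N x \<le> M N)"
proof (induction r)
  \<comment> \<open>Serves the base case as well, where the preceding remainder is taken to be 0 and
    \<open>K = 0\<close>.\<close>
  have step: "\<exists>M. M \<longlonglongrightarrow> 0 \<and>
    (\<forall>N x. N > 0 \<longrightarrow> 0 \<le> x \<longrightarrow> x \<le> t \<longrightarrow> 0 \<le> sin_expansion_rem r N x \<and> sin_expansion_rem r N x \<le> M N)"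
    if K: "K \<longlonglongrightarrow> 0" and prev: "\<And>N x. N > 0 \<Longrightarrow> 0 \<le> x \<Longrightarrow> x \<le> t \<Longrightarrow>
      0 \<le> (case r of 0 \<Rightarrow> 0 | Suc r' \<Rightarrow> sin_expansion_rem r' N x) \<and>
      (case r of 0 \<Rightarrow> 0 | Suc r' \<Rightarrow> sin_expansion_rem r' N x) \<le> K N"
    for r and K :: "nat \<Rightarrow> real"
  proof (intro exI conjI allI impI)
    let ?B = "\<lambda>N. (pi ^ 2 / 6) ^ r * (2 * real N * (2 * real N + 1)) * sin t ^ (2 * N - 1)"
    have "0 \<le> sin t" using assms by (intro sin_ge_zero) auto
    moreover have "sin t < 1" using assms sin_monotone_2pi[of t "pi / 2"] by simp
    ultimately have "?B \<longlonglongrightarrow> 0"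
      by (rule sin_expansion_defect_bound_tendsto_0)
    from tendsto_mult_right[OF tendsto_add[OF K this], of "t ^ 2"]
    show "(\<lambda>N. (K N + ?B N) * t ^ 2) \<longlonglongrightarrow> 0" by simp
    fix N x assume N: "N > (0::nat)" and x: "0 \<le> x" "x \<le> t"
    \<comment> \<open>At 0 only the summand \<open>n = 0\<close> can survive. For
      \<open>r = 0\<close> it cancels the power, which is why \<open>N > 0\<close> is assumed; for
      \<open>r > 0\<close> both vanish, \<open>odd_esym r 0\<close> being an empty sum.\<close>
    have d0: "sin_expansion_rem_deriv r N 0 = 0"
    proof -
      have "odd_esym r 0 = (if r = 0 then 1 else 0)" by (cases r) auto
      moreover obtain N' where "N = Suc N'" using N gr0_implies_Suc by blast
      ultimately show ?thesis
        by (simp add: sin_expansion_rem_deriv_def sum.lessThan_Suc_shift del: sum.lessThan_Suc)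
    qed
    have b: "0 \<le> (case r of 0 \<Rightarrow> 0 | Suc r' \<Rightarrow> sin_expansion_rem r' N y) + sin_expansion_defect r N y \<and>
        (case r of 0 \<Rightarrow> 0 | Suc r' \<Rightarrow> sin_expansion_rem r' N y) + sin_expansion_defect r N y \<le> K N + ?B N"
      if "0 \<le> y" "y \<le> x" for y
    proof -
      have y: "0 \<le> y" "y \<le> t" using that x by auto
      have "t \<le> pi / 2" using assms by simp
      from sin_expansion_defect_bounds[OF y this, of r N] prev[OF N y]
      show ?thesis by linarith
    qed
    note so = second_order_bounds[OF DERIV_sin_expansion_rem DERIV_sin_expansion_rem_deriv _ d0 x(1) b]
    have 0: "sin_expansion_rem r N 0 = 0"
      by (simp add: sin_expansion_rem_def sin_expansion_def)
    show "0 \<le> sin_expansion_rem r N x" using so(1)[OF 0] by simp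
    have "sin_expansion_rem r N x \<le> (K N + ?B N) * x ^ 2" using so(2)[OF 0] by simp
    also have "\<dots> \<le> (K N + ?B N) * t ^ 2"
      using x b[of 0] by (intro mult_left_mono power_mono) auto
    finally show "sin_expansion_rem r N x \<le> (K N + ?B N) * t ^ 2" .
  qed
  {
    case 0
    show ?case by (rule step[of "\<lambda>_. 0"]) auto
  next
    case (Suc r)
    then obtain M where "M \<longlonglongrightarrow> 0" "\<And>N x. N > 0 \<Longrightarrow> 0 \<le> x \<Longrightarrow> x \<le> t \<Longrightarrow>
        0 \<le> sin_expansion_rem r N x \<and> sin_expansion_rem r N x \<le> M N" by blast
    then show ?case by (intro step[of M]) auto
  }
qed

lemma sin_expansion_tendsto:
  assumes "0 \<le> x" "x < pi / 2"
  shows "(\<lambda>N. sin_expansion r N x) \<longlonglongrightarrow> x ^ (2 * r + 1) / fact (2 * r + 1)"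
proof -
  obtain M where M: "M \<longlonglongrightarrow> 0" "\<And>N. N > 0 \<Longrightarrow> 0 \<le> sin_expansion_rem r N x \<and> sin_expansion_rem r N x \<le> M N"
    using sin_expansion_rem_bounds[OF assms, of r] assms by blast
  have "(\<lambda>N. sin_expansion_rem r N x) \<longlonglongrightarrow> 0"
    by (rule tendsto_sandwich[OF _ _ tendsto_const M(1)])
      (auto intro!: eventually_mono[OF eventually_gt_at_top[of 0]] dest: M(2))
  from tendsto_diff[OF tendsto_const[of "x ^ (2 * r + 1) / fact (2 * r + 1)"] this]
  show ?thesis by (simp add: sin_expansion_rem_def)
qed

lemma sin_expansion_le:
  assumes "0 \<le> x" "x < pi / 2" "N > 0"
  shows "sin_expansion r N x \<le> x ^ (2 * r + 1) / fact (2 * r + 1)"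
  using sin_expansion_rem_bounds[OF assms(1,2), of r] assms
  by (fastforce simp: sin_expansion_rem_def)

text \<open>Dominated convergence: the partial sums are nonnegative and never exceed their limit, so
  with a nonnegative weight the limit itself is an integrable majorant. The open interval allows a
  weight singular at 0 and avoids \<open>pi/2\<close>, where the expansion has not been
  established.\<close>

lemma sums_integral_sin_expansion:
  assumes I: "\<And>n. ((\<lambda>x. sin x ^ (2 * n + 1) * w x) has_integral I n) {0<..<pi/2}"
    and w: "\<And>x. 0 < x \<Longrightarrow> x < pi / 2 \<Longrightarrow> 0 \<le> w x"
    and f: "((\<lambda>x. x ^ (2 * r + 1) / fact (2 * r + 1) * w x) has_integral J) {0<..<pi/2}"
  shows "(\<lambda>n. odd_esym r n * arcsin_coeff n * I n) sums J"
proof -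
  let ?f = "\<lambda>x. x ^ (2 * r + 1) / fact (2 * r + 1) * w x"
  have S: "((\<lambda>x. sin_expansion r N x * w x) has_integral
      (\<Sum>n<N. odd_esym r n * arcsin_coeff n * I n)) {0<..<pi/2}" for N
    unfolding sin_expansion_def sum_distrib_right mult.assoc[of _ _ "w _"]
    by (intro has_integral_sum has_integral_mult_right I) auto
  \<comment> \<open>The index is \<open>Suc N\<close> because the upper bound on partial sums is
    available for positive length.\<close>
  have "(\<lambda>N. integral {0<..<pi/2} (\<lambda>x. sin_expansion r (Suc N) x * w x))
      \<longlonglongrightarrow> integral {0<..<pi/2} ?f"
  proof (rule dominated_convergence)
    show "(\<lambda>x. sin_expansion r (Suc N) x * w x) integrable_on {0<..<pi/2}" for N
      using S by (auto simp: integrable_on_def)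
    show "?f integrable_on {0<..<pi/2}" using f by (auto simp: integrable_on_def)
  next
    fix N x assume x: "x \<in> {0<..<pi/2}"
    have "0 \<le> sin x" using x by (intro sin_ge_zero) auto
    then have "0 \<le> sin_expansion r (Suc N) x"
      unfolding sin_expansion_def
      by (intro sum_nonneg mult_nonneg_nonneg) (auto simp: odd_esym_nonneg arcsin_coeff_pos less_imp_le)
    moreover have "sin_expansion r (Suc N) x * w x \<le> ?f x"
      using x w by (intro mult_right_mono sin_expansion_le) auto
    ultimately show "norm (sin_expansion r (Suc N) x * w x) \<le> ?f x"
      using w x by auto
  next
    fix x assume "x \<in> {0<..<pi/2}"
    then show "(\<lambda>N. sin_expansion r (Suc N) x * w x) \<longlonglongrightarrow> ?f x"
      by (intro tendsto_intros LIMSEQ_Suc sin_expansion_tendsto) auto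
  qed
  then have "(\<lambda>N. \<Sum>n<Suc N. odd_esym r n * arcsin_coeff n * I n) \<longlonglongrightarrow> J"
    by (simp only: integral_unique[OF S] integral_unique[OF f])
  then show ?thesis unfolding sums_def by (rule LIMSEQ_imp_Suc)
qed

section \<open>Integrals against the sine expansion\<close>

lemma has_integral_Ioo_by_deriv:
  fixes F f :: "real \<Rightarrow> real"
  assumes "a \<le> b" "\<And>x. (F has_real_derivative f x) (at x)"
  shows "(f has_integral F b - F a) {a<..<b}"
  unfolding has_integral_Icc_iff_Ioo[symmetric]
  by (rule fundamental_theorem_of_calculus[OF assms(1)])
     (auto intro: DERIV_subset[OF assms(2)] simp flip: has_real_derivative_iff_has_vector_derivative)

text \<open>Wallis' integrals, by induction: \<open>- sin^(2n+2) * cos\<close> vanishes at both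
  endpoints, so integrating its derivative links consecutive odd powers. In this form the value
  cancels \<open>arcsin_coeff n\<close> in the termwise integrated expansion.\<close>

lemma has_integral_sin_odd_power:
  "((\<lambda>x. sin x ^ (2 * n + 1)) has_integral 1 / ((2 * real n + 1) ^ 2 * arcsin_coeff n)) {0<..<pi/2}"
proof (induction n)
  case 0
  have "(sin has_integral (- cos (pi / 2)) - (- cos 0)) {0<..<pi/2}"
    by (rule has_integral_Ioo_by_deriv) (auto intro!: derivative_eq_intros)
  then show ?case by simp
next
  case (Suc n)
  have "((\<lambda>x. - (sin x ^ (2 * n + 2) * cos x)) has_real_derivative
      ((2 * real n + 3) * sin x ^ (2 * n + 3) - (2 * real n + 2) * sin x ^ (2 * n + 1))) (at x)" for x
  proof -
    have "((\<lambda>x. - (sin x ^ (2 * n + 2) * cos x)) has_real_derivative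
        sin x ^ (2 * n + 3) - (2 * real n + 2) * sin x ^ (2 * n + 1) * cos x ^ 2) (at x)"
      using DERIV_minus[OF DERIV_mult[OF DERIV_sin_power[of "2 * n + 1" x] DERIV_cos[of x]]]
      by (simp add: algebra_simps power2_eq_square numeral_3_eq_3)
    also have "sin x ^ (2 * n + 3) - (2 * real n + 2) * sin x ^ (2 * n + 1) * cos x ^ 2 =
        (2 * real n + 3) * sin x ^ (2 * n + 3) - (2 * real n + 2) * sin x ^ (2 * n + 1)"
    proof -
      have s: "sin x ^ (2 * n + 3) = sin x ^ (2 * n + 1) * sin x ^ 2"
        by (simp add: numeral_3_eq_3 power2_eq_square)
      show ?thesis by (simp only: s cos_squared_eq) (simp add: algebra_simps)
    qed
    finally show ?thesis .
  qed
  from has_integral_Ioo_by_deriv[OF _ this, of 0 "pi / 2"]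
  have "((\<lambda>x. (2 * real n + 3) * sin x ^ (2 * n + 3) - (2 * real n + 2) * sin x ^ (2 * n + 1))
      has_integral 0) {0<..<pi/2}" by simp
  from has_integral_add[OF this has_integral_mult_right[OF Suc.IH, of "2 * real n + 2"]]
  have "((\<lambda>x. (2 * real n + 3) * sin x ^ (2 * n + 3)) has_integral
      (2 * real n + 2) / ((2 * real n + 1) ^ 2 * arcsin_coeff n)) {0<..<pi/2}" by simp
  from has_integral_mult_right[OF this, of "1 / (2 * real n + 3)"]
  have "((\<lambda>x. sin x ^ (2 * n + 3)) has_integral
      1 / (2 * real n + 3) * ((2 * real n + 2) / ((2 * real n + 1) ^ 2 * arcsin_coeff n))) {0<..<pi/2}"
    by (simp add: add_nonneg_eq_0_iff)
  moreover have "1 / (2 * real n + 3) * ((2 * real n + 2) / ((2 * real n + 1) ^ 2 * arcsin_coeff n)) =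
      1 / ((2 * real (Suc n) + 1) ^ 2 * arcsin_coeff (Suc n))"
  proof -
    \<comment> \<open>To be read with \<open>d = 2 * n + 1\<close> and
      \<open>A = arcsin_coeff n\<close>; the last factor is the recursion for the next
      coefficient.\<close>
    have "1 / (d + 2) * ((d + 1) / (d ^ 2 * A)) = 1 / ((d + 2) ^ 2 * (A * d ^ 2 / ((d + 1) * (d + 2))))"
      if "d > 0" "A > 0" for d A :: real
      using that by (simp add: divide_simps power2_eq_square)
    from this[of "2 * real n + 1" "arcsin_coeff n"] show ?thesis
      by (simp add: arcsin_coeff_pos add_ac)
  qed
  moreover have "2 * Suc n + 1 = 2 * n + 3" by simp
  ultimately show ?case by (simp only:)
qed

text \<open>Integration by parts: \<open>sin^(2n+1) * (pi/2 - x)\<close> vanishes at both endpoints,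
  which reduces the integral to Wallis' and brings one more factor \<open>1 / (2n + 1)\<close>, the
  source of the exponent 3.\<close>

lemma has_integral_sin_even_power_cos:
  "((\<lambda>x. sin x ^ (2 * n) * cos x * (pi / 2 - x)) has_integral
     1 / ((2 * real n + 1) ^ 3 * arcsin_coeff n)) {0<..<pi/2}"
proof -
  have "((\<lambda>x. sin x ^ (2 * n + 1) * (a - x)) has_real_derivative
      (2 * real n + 1) * (sin x ^ (2 * n) * cos x * (a - x)) - sin x ^ (2 * n + 1)) (at x)" for a x
  proof -
    have "((\<lambda>x. a - x) has_real_derivative - 1) (at x)"
      by (auto intro!: derivative_eq_intros)
    from DERIV_mult[OF DERIV_sin_power[of "2 * n" x] this] show ?thesis
      by (simp add: algebra_simps)
  qed
  from has_integral_Ioo_by_deriv[OF _ this, of 0 "pi / 2" "pi / 2"]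
  have "((\<lambda>x. (2 * real n + 1) * (sin x ^ (2 * n) * cos x * (pi / 2 - x)) - sin x ^ (2 * n + 1))
      has_integral 0) {0<..<pi/2}" by simp
  from has_integral_mult_right[OF has_integral_add[OF this has_integral_sin_odd_power[of n]],
      of "1 / (2 * real n + 1)"]
  show ?thesis by (simp add: add_nonneg_eq_0_iff power3_eq_cube power2_eq_square mult.assoc)
qed

text \<open>With \<open>a = pi/2\<close> and \<open>m = 2n + 2r\<close> this Beta integral yields
  the denominators of the zeta series.\<close>

lemma has_integral_monomial_diff:
  "((\<lambda>x. x ^ m * (a - x)) has_integral a ^ (m + 2) / ((real m + 1) * (real m + 2))) {0<..<a}"
  if "a \<ge> 0" for a :: real
proof -
  have "((\<lambda>x. a * (x ^ (m + 1) / (real m + 1)) - x ^ (m + 2) / (real m + 2)) has_real_derivative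
      x ^ m * (a - x)) (at x)" for x
  proof -
    have "((\<lambda>x. x ^ (m + 1) / (real m + 1)) has_real_derivative x ^ m) (at x)"
      using DERIV_cdivide[OF DERIV_pow[of "m + 1" x], of "real m + 1"] by (simp add: add.commute)
    moreover have "((\<lambda>x. x ^ (m + 2) / (real m + 2)) has_real_derivative x ^ (m + 1)) (at x)"
      using DERIV_cdivide[OF DERIV_pow[of "m + 2" x], of "real m + 2"] by (simp add: add.commute)
    ultimately have "((\<lambda>x. a * (x ^ (m + 1) / (real m + 1)) - x ^ (m + 2) / (real m + 2))
        has_real_derivative a * x ^ m - x ^ (m + 1)) (at x)"
      by (intro DERIV_diff DERIV_cmult)
    then show ?thesis by (simp add: algebra_simps)
  qed
  from has_integral_Ioo_by_deriv[OF that this]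
  have "((\<lambda>x. x ^ m * (a - x)) has_integral
      a * (a ^ (m + 1) / (real m + 1)) - a ^ (m + 2) / (real m + 2)) {0<..<a}" by simp
  also have "a * (a ^ (m + 1) / (real m + 1)) - a ^ (m + 2) / (real m + 2) =
      a ^ (m + 2) / ((real m + 1) * (real m + 2))"
    by (simp add: divide_simps add_nonneg_eq_0_iff) (simp add: algebra_simps)
  finally show ?thesis .
qed

text \<open>The expansion integrated against the weight 1: Wallis' integrals leave the series
  \<open>odd_esym r n / (2n + 1)^2\<close>, while the power integrates directly.\<close>

lemma mtv_twos: "mtv (replicate (Suc r) 2) = (pi / 2) ^ (2 * r + 2) / fact (2 * r + 2)"
proof -
  have "((\<lambda>x. x ^ (2 * r + 2) / fact (2 * r + 2)) has_real_derivative
      x ^ (2 * r + 1) / fact (2 * r + 1) * 1) (at x)" for x :: real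
  proof -
    have "real (2 * r + 2) \<noteq> 0" "fact (2 * r + 2) = real (2 * r + 2) * fact (2 * r + 1)"
      by (simp_all add: algebra_simps)
    then show ?thesis
      using DERIV_cdivide[OF DERIV_pow[of "2 * r + 2" x], of "fact (2 * r + 2)"]
      by (simp del: fact_Suc of_nat_add of_nat_mult)
  qed
  from has_integral_Ioo_by_deriv[OF _ this, of 0 "pi / 2"]
  have "((\<lambda>x. x ^ (2 * r + 1) / fact (2 * r + 1) * 1) has_integral
      (pi / 2) ^ (2 * r + 2) / fact (2 * r + 2)) {0<..<pi/2}" by simp
  from sums_integral_sin_expansion[OF _ _ this, of "\<lambda>n. 1 / ((2 * real n + 1) ^ 2 * arcsin_coeff n)"]
  have "(\<lambda>n. odd_esym r n * arcsin_coeff n * (1 / ((2 * real n + 1) ^ 2 * arcsin_coeff n))) sums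
      ((pi / 2) ^ (2 * r + 2) / fact (2 * r + 2))"
    using has_integral_sin_odd_power by simp
  also have "(\<lambda>n. odd_esym r n * arcsin_coeff n * (1 / ((2 * real n + 1) ^ 2 * arcsin_coeff n))) =
      (\<lambda>n. odd_esym r n / (2 * real n + 1) ^ 2)"
    using arcsin_coeff_pos by (simp add: less_imp_neq[symmetric])
  finally show ?thesis
    using mtv_eqI[of r 2] by (simp add: replicate_append_same)
qed

text \<open>The weight \<open>(pi/2 - x) * cot x\<close> lowers the power of the sine by one and so
  leads to the integrals with a cubed denominator. Existence and value \<open>J\<close> of the
  integral are supplied later by the cotangent series.\<close>

lemma mtv_twos_three:
  assumes "((\<lambda>x. x ^ (2 * r + 1) / fact (2 * r + 1) * (cos x / sin x * (pi / 2 - x))) has_integral J) {0<..<pi/2}"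
  shows "mtv (replicate r 2 @ [3]) = J"
proof (rule mtv_eqI)
  have "(\<lambda>n. odd_esym r n * arcsin_coeff n * (1 / ((2 * real n + 1) ^ 3 * arcsin_coeff n))) sums J"
  proof (rule sums_integral_sin_expansion[OF _ _ assms])
    fix n
    have "((\<lambda>x. sin x ^ (2 * n + 1) * (cos x / sin x * (pi / 2 - x))) has_integral
        1 / ((2 * real n + 1) ^ 3 * arcsin_coeff n)) {0<..<pi/2} \<longleftrightarrow>
        ((\<lambda>x. sin x ^ (2 * n) * cos x * (pi / 2 - x)) has_integral
        1 / ((2 * real n + 1) ^ 3 * arcsin_coeff n)) {0<..<pi/2}"
    proof (rule has_integral_cong)
      fix x assume "x \<in> {0<..<pi/2}"
      then have "sin x > 0" by (intro sin_gt_zero) auto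
      then show "sin x ^ (2 * n + 1) * (cos x / sin x * (pi / 2 - x)) = sin x ^ (2 * n) * cos x * (pi / 2 - x)"
        by simp
    qed
    then show "((\<lambda>x. sin x ^ (2 * n + 1) * (cos x / sin x * (pi / 2 - x))) has_integral
        1 / ((2 * real n + 1) ^ 3 * arcsin_coeff n)) {0<..<pi/2}"
      using has_integral_sin_even_power_cos by simp
  next
    fix x :: real assume "0 < x" "x < pi / 2"
    then show "0 \<le> cos x / sin x * (pi / 2 - x)"
      by (intro mult_nonneg_nonneg divide_nonneg_nonneg cos_ge_zero sin_ge_zero) auto
  qed
  also have "(\<lambda>n. odd_esym r n * arcsin_coeff n * (1 / ((2 * real n + 1) ^ 3 * arcsin_coeff n))) =
      (\<lambda>n. odd_esym r n / (2 * real n + 1) ^ 3)"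
    using arcsin_coeff_pos by (simp add: less_imp_neq[symmetric])
  finally show "(\<lambda>n. odd_esym r n / (2 * real n + 1) ^ 3) sums J" .
qed

section \<open>The cotangent and even zeta values\<close>

lemma zeta_even_sums: "n > 0 \<Longrightarrow> (\<lambda>k. 1 / real (Suc k) ^ (2 * n)) sums zeta_even n"
  using inverse_power_summable[of "2 * n", where 'a = real] summable_Suc_iff[of "\<lambda>k. inverse (real k ^ (2 * n))"]
  by (simp add: zeta_even_def summable_sums inverse_eq_divide)

lemma zeta_even_nonneg: "n > 0 \<Longrightarrow> zeta_even n \<ge> 0"
  using sums_le[OF _ sums_zero zeta_even_sums[of n]] by simp

text \<open>For \<open>n > 0\<close> the values are at most zeta(2), and \<open>pi < 3.2\<close>
  bounds that by 2; for \<open>n = 0\<close> the absolute value is \<open>1/2\<close>.\<close>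

lemma abs_zeta_even_le: "\<bar>zeta_even n\<bar> \<le> 2"
proof (cases "n = 0")
  case False
  then have n: "n > 0" by simp
  have "zeta_even n \<le> pi ^ 2 / 6"
  proof (rule sums_le[OF _ zeta_even_sums[OF n] inverse_squares_sums])
    fix k
    have "real (Suc k) ^ 2 \<le> real (Suc k) ^ (2 * n)" using n by (intro power_increasing) auto
    then show "1 / real (Suc k) ^ (2 * n) \<le> 1 / real ((k + 1) ^ 2)"
      by (intro divide_left_mono) auto
  qed
  also have "pi ^ 2 \<le> 3.2 ^ 2" using pi_approx by (intro power_mono) auto
  then have "pi ^ 2 / 6 \<le> 2" by (simp add: power2_eq_square)
  finally show ?thesis using zeta_even_nonneg[OF n] by simp
qed (simp add: zeta_even_def)

lemma ln_one_minus_sums: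
  assumes "0 \<le> u" "u < (1::real)"
  shows "(\<lambda>m. u ^ Suc m / real (Suc m)) sums (- ln (1 - u))"
proof -
  have "(\<lambda>n. - ((- (- u)) ^ n) / of_nat n) sums ln (1 + (- u))"
    using assms by (intro ln_series') auto
  from sums_minus[OF this] have "(\<lambda>n. u ^ n / real n) sums (- ln (1 - u))"
    by simp
  \<comment> \<open>The term \<open>n = 0\<close> is a division by 0, hence 0, so the index shift
    loses nothing.\<close>
  then show ?thesis using sums_Suc_iff[of "\<lambda>n. u ^ n / real n" "- ln (1 - u)"] by simp
qed

text \<open>Logarithm of Euler's sine product; the factors and the limit are positive for
  \<open>0 < x < 1\<close>.\<close>

lemma ln_sinc_sums:
  assumes "0 < x" "x < 1"
  shows "(\<lambda>k. ln (1 - x ^ 2 / real (Suc k) ^ 2)) sums ln (sin (pi * x) / (pi * x))"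
proof -
  have pos: "1 - x ^ 2 / real (Suc k) ^ 2 > 0" for k
  proof -
    have "x ^ 2 < 1" using assms by (simp add: power_less_one_iff)
    also have "1 \<le> real (Suc k) ^ 2" by (intro one_le_power) simp
    finally show ?thesis by (simp add: divide_less_eq del: of_nat_Suc)
  qed
  have "sin (pi * x) > 0" using assms by (intro sin_gt_zero) auto
  with assms have lim: "sin (pi * x) / (pi * x) > 0" by simp
  have "(\<lambda>n. \<Prod>k<n. 1 - x ^ 2 / real (Suc k) ^ 2) \<longlonglongrightarrow> sin (pi * x) / (pi * x)"
    using sin_product_formula_real'[of x] assms
    by (simp add: prod.atLeast1_atMost_eq)
  then have "(\<lambda>n. ln (\<Prod>k<n. 1 - x ^ 2 / real (Suc k) ^ 2)) \<longlonglongrightarrow> ln (sin (pi * x) / (pi * x))"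
    using lim by (intro tendsto_ln) auto
  also have "(\<lambda>n. ln (\<Prod>k<n. 1 - x ^ 2 / real (Suc k) ^ 2)) = (\<lambda>n. \<Sum>k<n. ln (1 - x ^ 2 / real (Suc k) ^ 2))"
  proof (intro ext ln_prod)
    show "1 - x ^ 2 / real (Suc k) ^ 2 \<noteq> 0" for k using pos[of k] by linarith
  qed simp
  finally show ?thesis by (simp add: sums_def)
qed

text \<open>Each logarithm of a factor is expanded in powers of \<open>x^2 / k^2\<close>. Summing
  over \<open>k\<close> first produces the zeta values, and the interchange is allowed because all
  terms of the double series are nonnegative.\<close>

lemma ln_sinc_zeta_sums:
  assumes "0 < x" "x < 1"
  shows "(\<lambda>m. zeta_even (Suc m) / real (Suc m) * (x ^ 2) ^ Suc m) sums (- ln (sin (pi * x) / (pi * x)))"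
proof -
  define t where "t = (\<lambda>(k, m). (x ^ 2 / real (Suc k) ^ 2) ^ Suc m / real (Suc m))"
  have u: "0 \<le> x ^ 2 / real (Suc k) ^ 2" "x ^ 2 / real (Suc k) ^ 2 < 1" for k
  proof -
    have "x ^ 2 < 1" using assms by (simp add: power_less_one_iff)
    also have "1 \<le> real (Suc k) ^ 2" by (intro one_le_power) simp
    finally show "x ^ 2 / real (Suc k) ^ 2 < 1" by (simp add: divide_less_eq del: of_nat_Suc)
  qed simp
  have t_nonneg: "t p \<ge> 0" for p by (auto simp: t_def split: prod.splits)
  have inner: "((\<lambda>m. t (k, m)) has_sum (- ln (1 - x ^ 2 / real (Suc k) ^ 2))) UNIV" for k
    using ln_one_minus_sums[OF u[of k]] t_nonneg[of "(k, _)"]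
    by (intro sums_nonneg_imp_has_sum) (auto simp: t_def)
  have outer: "((\<lambda>k. - ln (1 - x ^ 2 / real (Suc k) ^ 2)) has_sum (- ln (sin (pi * x) / (pi * x)))) UNIV"
  proof (rule sums_nonneg_imp_has_sum)
    show "0 \<le> - ln (1 - x ^ 2 / real (Suc k) ^ 2)" for k
      using u[of k] by (simp add: ln_le_zero_iff)
  qed (intro sums_minus ln_sinc_sums assms)
  have "(t has_sum (- ln (sin (pi * x) / (pi * x)))) (UNIV \<times> UNIV)"
    by (rule has_sum_SigmaI[OF inner outer])
       (rule summable_on_SigmaI[OF inner], use outer t_nonneg in \<open>auto simp: summable_on_def\<close>)
  then have swapped: "((\<lambda>(m, k). t (k, m)) has_sum (- ln (sin (pi * x) / (pi * x)))) (UNIV \<times> UNIV)"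
    by (subst (asm) has_sum_swap)
  have "((\<lambda>m. zeta_even (Suc m) / real (Suc m) * (x ^ 2) ^ Suc m) has_sum
      (- ln (sin (pi * x) / (pi * x)))) UNIV"
  proof (rule has_sum_SigmaD[OF swapped])
    fix m
    have "(\<lambda>k. (x ^ 2) ^ Suc m / real (Suc m) * (1 / real (Suc k) ^ (2 * Suc m))) sums
        ((x ^ 2) ^ Suc m / real (Suc m) * zeta_even (Suc m))"
      by (intro sums_mult zeta_even_sums) simp
    also have "(\<lambda>k. (x ^ 2) ^ Suc m / real (Suc m) * (1 / real (Suc k) ^ (2 * Suc m))) = (\<lambda>k. t (k, m))"
      unfolding t_def prod.case power_divide power_mult
      by (simp only: times_divide_eq_right mult_1_right mult_1_left divide_divide_eq_left mult.commute)
    finally have "((\<lambda>k. t (k, m)) has_sum ((x ^ 2) ^ Suc m / real (Suc m) * zeta_even (Suc m))) UNIV"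
      by (rule sums_nonneg_imp_has_sum) (rule t_nonneg)
    then show "((\<lambda>k. case (m, k) of (m, k) \<Rightarrow> t (k, m)) has_sum
        zeta_even (Suc m) / real (Suc m) * (x ^ 2) ^ Suc m) UNIV"
      by (simp add: mult.commute)
  qed
  then show ?thesis by (rule has_sum_imp_sums)
qed

text \<open>Differentiates the logarithmic series and multiplies by \<open>x / 2\<close>. The pole
  term \<open>1 / x\<close> becomes \<open>1/2\<close>, which is accounted for by zeta(0) = -1/2 at
  \<open>n = 0\<close>.\<close>

lemma cot_zeta_even_sums:
  assumes "0 < x" "x < 1"
  shows "(\<lambda>n. zeta_even n * x ^ (2 * n)) sums (- (pi * x / 2) * (cos (pi * x) / sin (pi * x)))"
proof -
  \<comment> \<open>\<open>c 0 = 0\<close> by \<open>x / 0 = 0\<close>, so that the power series has no constant term\<close>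
  define c where "c n = zeta_even n / real n" for n
  define P where "P u = (\<Sum>n. c n * u ^ n)" for u
  have P: "(\<lambda>n. c n * (y ^ 2) ^ n) sums (- ln (sin (pi * y) / (pi * y)))" if "0 < y" "y < 1" for y
    by (rule sums_Suc_imp) (use ln_sinc_zeta_sums[OF that] in \<open>simp_all add: c_def\<close>)
  \<comment> \<open>The midpoint of \<open>x\<close> and 1 provides a point of convergence beyond
    \<open>x ^ 2\<close>, as termwise differentiation requires.\<close>
  have x2: "(x ^ 2) < ((1 + x) / 2) ^ 2" using assms by (intro power_strict_mono) auto
  have "summable (\<lambda>n. c n * (((1 + x) / 2) ^ 2) ^ n)"
    using P[of "(1 + x) / 2"] assms by (intro sums_summable) auto
  from termdiffs_strong[OF this, of "x ^ 2"] x2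
  have dP: "(P has_real_derivative (\<Sum>n. diffs c n * (x ^ 2) ^ n)) (at (x ^ 2))"
    by (simp add: P_def[abs_def])
  have diffs: "diffs c n = zeta_even (Suc n)" for n by (simp add: diffs_def c_def)
  have sin_pos: "sin (pi * x) > 0" using assms by (intro sin_gt_zero) auto
  have "((\<lambda>x. P (x ^ 2)) has_real_derivative (\<Sum>n. diffs c n * (x ^ 2) ^ n) * (2 * x)) (at x)"
    by (rule DERIV_chain2[where f = P and g = "\<lambda>x. x ^ 2", OF dP]) (auto intro!: derivative_eq_intros)
  moreover have "((\<lambda>x. P (x ^ 2)) has_real_derivative
      - (pi * cos (pi * x) / sin (pi * x) - 1 / x)) (at x)"
  proof (rule has_field_derivative_transform_within_open[of "\<lambda>x. - (ln (sin (pi * x)) - ln (pi * x))" _ _ "{0<..<1}"])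
    show "((\<lambda>x. - (ln (sin (pi * x)) - ln (pi * x))) has_real_derivative
      - (pi * cos (pi * x) / sin (pi * x) - 1 / x)) (at x)"
      using assms sin_pos by (auto intro!: derivative_eq_intros)
    fix y :: real assume y: "y \<in> {0<..<1}"
    then have "sin (pi * y) > 0" by (intro sin_gt_zero) auto
    with y P[of y] show "- (ln (sin (pi * y)) - ln (pi * y)) = P (y ^ 2)"
      by (auto simp: P_def sums_iff ln_div)
  qed (use assms in auto)
  ultimately have eq: "(\<Sum>n. diffs c n * (x ^ 2) ^ n) * (2 * x) = - (pi * cos (pi * x) / sin (pi * x) - 1 / x)"
    by (rule DERIV_unique)
  have "summable (\<lambda>n. diffs c n * (x ^ 2) ^ n)"
  proof (rule summable_comparison_test')
    show "summable (\<lambda>n. 2 * (x ^ 2) ^ n)"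
      using assms by (intro summable_mult summable_geometric) (simp add: power_less_one_iff)
    show "norm (diffs c n * (x ^ 2) ^ n) \<le> 2 * (x ^ 2) ^ n" for n
      unfolding diffs by (simp add: abs_mult mult_right_mono abs_zeta_even_le)
  qed
  from sums_mult[OF summable_sums[OF this], of "x ^ 2"]
  have "(\<lambda>n. zeta_even (Suc n) * x ^ (2 * Suc n)) sums (x ^ 2 * (\<Sum>n. diffs c n * (x ^ 2) ^ n))"
    by (simp add: diffs power_mult power2_eq_square power_mult_distrib mult_ac)
  also have "x ^ 2 * (\<Sum>n. diffs c n * (x ^ 2) ^ n) =
      - (pi * x / 2) * (cos (pi * x) / sin (pi * x)) - zeta_even 0 * x ^ (2 * 0)"
  proof -
    have "x ^ 2 * (\<Sum>n. diffs c n * (x ^ 2) ^ n) = x / 2 * ((\<Sum>n. diffs c n * (x ^ 2) ^ n) * (2 * x))"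
      by (simp add: power2_eq_square)
    then show ?thesis using assms by (simp only: eq) (simp add: zeta_even_def field_simps)
  qed
  finally show ?thesis
    using sums_Suc_iff[of "\<lambda>n. zeta_even n * x ^ (2 * n)"
        "- (pi * x / 2) * (cos (pi * x) / sin (pi * x)) - zeta_even 0 * x ^ (2 * 0)"]
    by (simp only: diff_add_cancel)
qed

text \<open>The factor \<open>x * cot x\<close> is replaced by its zeta series at
  \<open>x / pi\<close> and integrated termwise. Since \<open>x / pi \<le> 1/2\<close>, the series
  converges uniformly with ratio \<open>1/4\<close>.\<close>

lemma has_integral_cot_zeta_even:
  "((\<lambda>x. x ^ (2 * r + 1) * (cos x / sin x * (pi / 2 - x))) has_integral
     - 2 * (pi / 2) ^ (2 * r + 2) *
      (\<Sum>n. zeta_even n / ((2 * real n + 2 * real r + 1) * (2 * real n + 2 * real r + 2) * 2 ^ (2 * n))))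
   {0<..<pi/2}"
  (is "(?G has_integral _ * (\<Sum>n. ?a n)) _")
proof -
  \<comment> \<open>The terms are polynomials, so they are continuous on the closed interval; the
    cotangent form of their sum is used only in the interior.\<close>
  define T where "T n x = - 2 * (zeta_even n / pi ^ (2 * n)) * (x ^ (2 * n + 2 * r) * (pi / 2 - x))"
    for n and x :: real
  have T_int: "(T n has_integral - 2 * (pi / 2) ^ (2 * r + 2) * ?a n) {0<..<pi/2}" for n
  proof -
    have "(T n has_integral - 2 * (zeta_even n / pi ^ (2 * n)) *
        ((pi / 2) ^ (2 * n + 2 * r + 2) / ((real (2 * n + 2 * r) + 1) * (real (2 * n + 2 * r) + 2)))) {0<..<pi/2}"
      unfolding T_def by (intro has_integral_mult_right has_integral_monomial_diff) simp
    also have "- 2 * (zeta_even n / pi ^ (2 * n)) *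
        ((pi / 2) ^ (2 * n + 2 * r + 2) / ((real (2 * n + 2 * r) + 1) * (real (2 * n + 2 * r) + 2)))
        = - 2 * (pi / 2) ^ (2 * r + 2) * ?a n"
    proof -
      have "(pi / 2) ^ (2 * n + 2 * r + 2) = (pi / 2) ^ (2 * r + 2) * (pi ^ (2 * n) / 2 ^ (2 * n))"
        by (simp add: power_add power_divide mult_ac)
      then show ?thesis by (simp del: power_Suc add: add_ac mult_ac)
    qed
    finally show ?thesis .
  qed
  have T_le: "norm (T n x) \<le> 4 * pi * (pi / 2) ^ (2 * r) * (1 / 4) ^ n" if "x \<in> {0..pi/2}" for n x
  proof -
    have "norm (T n x) = 2 * \<bar>zeta_even n\<bar> * ((x / pi) ^ (2 * n) * x ^ (2 * r) * (pi / 2 - x))"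
      using that by (simp add: T_def abs_mult power_add power_divide)
    also have "\<dots> \<le> 2 * 2 * ((1 / 2) ^ (2 * n) * (pi / 2) ^ (2 * r) * pi)"
    proof -
      have "x / pi \<le> 1 / 2" "0 \<le> x" "x \<le> pi / 2" using that by (auto simp: field_simps)
      then show ?thesis
        by (intro mult_mono power_mono abs_zeta_even_le) (auto intro!: mult_nonneg_nonneg)
    qed
    also have "(1 / 2 :: real) ^ (2 * n) = (1 / 4) ^ n" by (simp add: power_mult power2_eq_square)
    finally show ?thesis by (simp add: mult_ac)
  qed
  have "uniform_limit {0..pi/2} (\<lambda>N x. \<Sum>n<N. T n x) (\<lambda>x. \<Sum>n. T n x) sequentially"
    by (rule Weierstrass_m_test[OF T_le]) (auto intro!: summable_mult summable_geometric)
  then obtain I J where IJ: "\<And>N. ((\<lambda>x. \<Sum>n<N. T n x) has_integral I N) {0..pi/2}"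
      "((\<lambda>x. \<Sum>n. T n x) has_integral J) {0..pi/2}" "I \<longlonglongrightarrow> J"
    by (rule uniform_limit_integral) (auto simp: T_def intro!: continuous_intros)
  have I: "I = (\<lambda>N. \<Sum>n<N. - 2 * (pi / 2) ^ (2 * r + 2) * ?a n)"
  proof (rule ext, rule has_integral_unique)
    fix N
    show "((\<lambda>x. \<Sum>n<N. T n x) has_integral I N) {0<..<pi/2}"
      using IJ(1)[of N] by (simp only: has_integral_Icc_iff_Ioo)
  qed (intro has_integral_sum T_int finite_lessThan)
  have "(\<lambda>n. - 2 * (pi / 2) ^ (2 * r + 2) * ?a n) sums J"
    using IJ(3) unfolding sums_def I .
  moreover have K: "- 2 * (pi / 2) ^ (2 * r + 2) \<noteq> 0" by simp
  ultimately have "(\<Sum>n. ?a n) = J / (- 2 * (pi / 2) ^ (2 * r + 2))"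
    by (intro sums_unique[symmetric] sums_mult_D)
  then have J: "J = - 2 * (pi / 2) ^ (2 * r + 2) * (\<Sum>n. ?a n)"
    by (metis K nonzero_eq_divide_eq mult.commute)
  have "((\<lambda>x. \<Sum>n. T n x) has_integral J) {0<..<pi/2}"
    using IJ(2) by (simp only: has_integral_Icc_iff_Ioo)
  then have "(?G has_integral J) {0<..<pi/2}"
  proof (rule has_integral_eq[rotated])
    fix x assume x: "x \<in> {0<..<pi/2}"
    have "(\<lambda>n. - 2 * (x ^ (2 * r) * (pi / 2 - x)) * (zeta_even n * (x / pi) ^ (2 * n))) sums
       (- 2 * (x ^ (2 * r) * (pi / 2 - x)) * (- (pi * (x / pi) / 2) * (cos (pi * (x / pi)) / sin (pi * (x / pi)))))"
      using x by (intro sums_mult cot_zeta_even_sums) (auto simp: divide_simps)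
    also have "(\<lambda>n. - 2 * (x ^ (2 * r) * (pi / 2 - x)) * (zeta_even n * (x / pi) ^ (2 * n))) = (\<lambda>n. T n x)"
      by (simp add: T_def power_add power_divide mult_ac)
    finally show "(\<Sum>n. T n x) = ?G x"
      by (simp add: sums_iff)
  qed
  then show ?thesis by (simp only: J)
qed

section \<open>Comparison of the two evaluations\<close>

theorem theorem3p2:
  fixes r :: nat
  shows "mtv (replicate r 2 @ [3]) =
    - 4 * real (r + 1) *
      (\<Sum>n. zeta_even n / ((2 * real n + 2 * real r + 1) * (2 * real n + 2 * real r + 2) * 2 ^ (2 * n)))
      * mtv (replicate (r + 1) 2)"
proof -
  define Z where "Z = (\<Sum>n. zeta_even n / ((2 * real n + 2 * real r + 1) * (2 * real n + 2 * real r + 2) * 2 ^ (2 * n)))"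
  have three: "mtv (replicate r 2 @ [3]) = 1 / fact (2 * r + 1) * (- 2 * (pi / 2) ^ (2 * r + 2) * Z)"
    using has_integral_mult_right[OF has_integral_cot_zeta_even[of r], of "1 / fact (2 * r + 1)"]
    by (intro mtv_twos_three) (simp add: Z_def del: fact_Suc)
  have twos: "mtv (replicate (r + 1) 2) = (pi / 2) ^ (2 * r + 2) / (2 * real (r + 1) * fact (2 * r + 1))"
  proof -
    have "fact (2 * r + 2) = 2 * real (r + 1) * fact (2 * r + 1)" by simp
    then show ?thesis using mtv_twos[of r] by (simp only: Suc_eq_plus1)
  qed
  \<comment> \<open>Here \<open>F = (2r + 1)!\<close>, \<open>s = r + 1\<close> and
    \<open>K = (pi/2)^(2r + 2)\<close>, so that \<open>(2r + 2)! = 2 * s * F\<close>.\<close>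
  have "1 / F * (- 2 * K * Z) = - 4 * s * Z * (K / (2 * s * F))"
    if "F \<noteq> 0" "s \<noteq> 0" for F K s :: real
    using that by simp
  from this[OF fact_nonzero of_nat_neq_0] show ?thesis
    unfolding Z_def[symmetric] three twos by (simp only: Suc_eq_plus1)
qed

end
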